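(* Let $k$ be a Riesel number constructed using the covering system method, i.e. $k$ is an odd positive integer for which there exist a covering system $\{r_j\pmod{m_j}:1\le j\le\tau\}$ and distinct primes $p_1,\dots,p_\tau$ with $p_j\mid 2^{m_j}-1$, such that $k\equiv 2^{-r_j}\pmod{p_j}$ and $k\cdot 2^n-1>p_j$ for all $1\le j\le\tau$ and all positive integers $n$. Then for every integer $b\ge2$ there exist infinitely many positive integers $t$ such that the $b$-repinteger $k_b^{(t)}$ is a Riesel number.
   Context: A covering system of the integers is a finite collection of congruences $r_j \pmod{m_j}$ such that every integer satisfies at least one of them. $2^{-r}\pmod p$ denotes the inverse of $2^r$ modulo the odd prime $p$. A Riesel number is an odd positive integer $k$ such that $k\cdot 2^n-1$ is composite for all positive integers $n$. For integers $b\ge2$, $k\ge1$, $t\ge1$, the $b$-repinteger is $k_b^{(t)}=k\,(b^{\ell t}-1)/(b^\ell-1)$ where $\ell=\lfloor\log_b k\rfloor+1$ is the number of base-$b$ digits of $k$. *)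

theory Defs
  imports Complex_Main "HOL-Number_Theory.Number_Theory"
begin

definition composite :: "nat \<Rightarrow> bool" where
  "composite n \<longleftrightarrow> n > 1 \<and> \<not> prime n"

(* Positivity of k follows from oddness; the truncated subtraction is exact since k * 2 ^ n > 0. *)
definition riesel :: "nat \<Rightarrow> bool" where
  "riesel k \<longleftrightarrow> odd k \<and> (\<forall>n>0. composite (k * 2 ^ n - 1))"

definition covering_system :: "'i set \<Rightarrow> ('i \<Rightarrow> int) \<Rightarrow> ('i \<Rightarrow> nat) \<Rightarrow> bool" where
  "covering_system J r m \<longleftrightarrow>
     finite J \<and> (\<forall>j\<in>J. m j > 0) \<and> (\<forall>n. \<exists>j\<in>J. [n = r j] (mod int (m j)))"

(* 2 ^ e modulo p for an arbitrary integer exponent e: for e = -r with r > 0 it is the inverse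
   of 2 ^ r modulo p. Meaningful only for odd p. *)
definition two_power_mod :: "nat \<Rightarrow> int \<Rightarrow> int" where
  "two_power_mod p e = (if e \<ge> 0 then 2 ^ nat e else modular_inverse (int p) (2 ^ nat (- e)))"

(* Each p j is automatically odd, being a divisor of 2 ^ m j - 1 with m j > 0. *)
definition covering_riesel :: "nat \<Rightarrow> bool" where
  "covering_riesel k \<longleftrightarrow> odd k \<and>
     (\<exists>(\<tau>::nat) (r :: nat \<Rightarrow> int) (m :: nat \<Rightarrow> nat) (p :: nat \<Rightarrow> nat).
        covering_system {1..\<tau>} r m \<and>
        inj_on p {1..\<tau>} \<and>
        (\<forall>j\<in>{1..\<tau>}.
           prime (p j) \<and> p j dvd 2 ^ m j - 1 \<and>
           [int k = two_power_mod (p j) (- r j)] (mod int (p j)) \<and>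
           (\<forall>n>0. k * 2 ^ n - 1 > p j)))"

definition num_digits :: "nat \<Rightarrow> nat \<Rightarrow> nat" where
  "num_digits b k = nat \<lfloor>log (real b) (real k)\<rfloor> + 1"

(* Intended for b \<ge> 2 and k, t \<ge> 1; the division is exact because
   b ^ l - 1 divides b ^ (l * t) - 1. *)
definition repinteger :: "nat \<Rightarrow> nat \<Rightarrow> nat \<Rightarrow> nat" where
  "repinteger b k t =
     (let l = num_digits b k in k * (b ^ (l * t) - 1) div (b ^ l - 1))"

end

theory Submission
  imports Defs
begin

text \<open>
  With \<open>B = b ^ l\<close>, the repinteger is \<open>k * (1 + B + \<dots> + B ^ (t - 1))\<close>. For a prime \<open>p\<close> the factor
  is \<open>1\<close> modulo \<open>p\<close> as soon as \<open>p * (p - 1)\<close> divides \<open>t - 1\<close>. Taking \<open>t - 1\<close> divisible by this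
  number for \<open>p = 2\<close> and for every covering prime, the repinteger is odd and is congruent to \<open>k\<close>
  modulo each covering prime, so the covering that works for \<open>k\<close> works for it too.
\<close>

lemma geometric_sum_nat:
  fixes x :: nat
  assumes "x \<ge> 1"
  shows "x ^ n - 1 = (x - 1) * (\<Sum>i<n. x ^ i)"
proof -
  have "int (x ^ n - 1) = int ((x - 1) * (\<Sum>i<n. x ^ i))"
    using assms power_diff_1_eq[of "int x" n] by (simp add: of_nat_diff)
  then show ?thesis by (simp only: of_nat_eq_iff)
qed

lemma repinteger_eq_geometric_sum:
  assumes "b \<ge> 2"
  shows "repinteger b k t = k * (\<Sum>i<t. (b ^ num_digits b k) ^ i)"
proof -
  define B where "B = b ^ num_digits b k"
  have "num_digits b k > 0" by (simp add: num_digits_def)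
  \<comment> \<open>\<open>B > 1\<close> makes the divisor \<open>B - 1\<close> nonzero, so it can
    be cancelled in the natural-number division below.\<close>
  then have "B > 1" using assms unfolding B_def by (intro one_less_power) auto
  moreover from this have "k * (B ^ t - 1) = k * (\<Sum>i<t. B ^ i) * (B - 1)"
    by (simp only: geometric_sum_nat less_imp_le mult_ac)
  ultimately have "k * (B ^ t - 1) div (B - 1) = k * (\<Sum>i<t. B ^ i)"
    by (metis nonzero_mult_div_cancel_right zero_less_diff less_irrefl)
  then show ?thesis
    by (simp only: repinteger_def Let_def power_mult flip: B_def)
qed

text \<open>Beyond its first term the sum is \<open>x\<close> times the sum of the first
  \<open>n\<close> powers, so \<open>p\<close> only has to divide this product. If \<open>p\<close>
  does not divide \<open>x\<close>, the factor \<open>p - 1\<close> of \<open>n\<close> and Fermat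
  give that \<open>p\<close> divides \<open>x ^ n - 1\<close>, hence \<open>x - 1\<close> or the
  shorter sum. In the case \<open>x = 1\<close> modulo \<open>p\<close> the shorter sum is congruent
  to \<open>n\<close>, which is why the factor \<open>p\<close> is required as well.\<close>

lemma geometric_sum_cong_1_mod_prime:
  fixes x p :: nat
  assumes p: "prime p" and n: "p * (p - 1) dvd n"
  shows "[(\<Sum>i<Suc n. x ^ i) = 1] (mod p)"
proof -
  have "p dvd x * (\<Sum>i<n. x ^ i)"
  proof (cases "p dvd x")
    case False
    then have x: "x \<ge> 1" by (cases x) auto
    have "[x ^ n = 1] (mod p)"
      using fermat_theorem[OF p False] n unfolding ord_divides by (rule dvd_trans[OF _ dvd_mult_right])
    then have "p dvd x ^ n - 1" using x by (simp add: cong_altdef_nat)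
    then have "p dvd (x - 1) * (\<Sum>i<n. x ^ i)" by (simp only: geometric_sum_nat[OF x])
    then consider "p dvd x - 1" | "p dvd (\<Sum>i<n. x ^ i)"
      using p prime_dvd_mult_iff by blast
    then show ?thesis
    proof cases
      case 1
      then have "[x = 1] (mod p)" using x by (simp add: cong_altdef_nat)
      then have "[x ^ i = 1] (mod p)" for i using cong_pow[of x 1 p i] by simp
      then have "[(\<Sum>i<n. x ^ i) = (\<Sum>i<n. 1)] (mod p)" by (intro cong_sum)
      moreover have "p dvd n" using n by (meson dvd_mult_left dvd_trans)
      ultimately show ?thesis by (simp add: cong_dvd_iff)
    qed simp
  qed simp
  moreover have "(\<Sum>i<Suc n. x ^ i) = 1 + x * (\<Sum>i<n. x ^ i)"
    by (subst sum.lessThan_Suc_shift) (simp add: sum_distrib_left)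
  ultimately show ?thesis
    using cong_altdef_nat[of 1 "\<Sum>i<Suc n. x ^ i" p] by simp
qed

text \<open>Powers of 2 modulo \<open>p\<close> depend only on the exponent modulo \<open>m\<close>,
  so \<open>n\<close> acts like \<open>r\<close>, whatever the sign of \<open>r\<close>.\<close>

lemma two_power_mod_uminus_mult:
  assumes p: "p dvd 2 ^ m - 1" and m: "m > 0" and n: "[int n = r] (mod int m)"
  shows "[two_power_mod p (- r) * 2 ^ n = 1] (mod int p)"
proof -
  have period: "[2 ^ m = 1] (mod p)"
    using p by (simp add: cong_altdef_nat)
  then have "coprime p (2 ^ m)"
    by (metis cong_imp_coprime cong_sym coprime_1_left coprime_commute)
  then have cop: "coprime p 2" using m by simp
  have ord: "ord p 2 dvd m" using period by (simp only: ord_divides)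
  have periodic: "[2 ^ d = 2 ^ e] (mod int p)" if "[int d = int e] (mod int m)" for d e
  proof -
    have "[d = e] (mod m)" using that by (simp only: cong_int_iff)
    then have "[2 ^ d = 2 ^ e] (mod p)"
      using order_divides_expdiff[OF cop] cong_dvd_modulus_nat ord by blast
    then show ?thesis by (simp flip: cong_int_iff)
  qed
  show ?thesis
  proof (cases "r \<le> 0")
    case True
    \<comment> \<open>Here \<open>two_power_mod\<close> is an ordinary power, and the two exponents
      add up to a multiple of \<open>m\<close>.\<close>
    then have "[int (nat (- r) + n) = int 0] (mod int m)"
      using n by (simp add: cong_iff_dvd_diff)
    from periodic[OF this] True show ?thesis
      by (simp add: two_power_mod_def power_add)
  next
    case False
    then have "[int n = int (nat r)] (mod int m)" using n by simp
    note periodic[OF this]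
    then have "[two_power_mod p (- r) * 2 ^ n = two_power_mod p (- r) * 2 ^ nat r] (mod int p)"
      by (rule cong_scalar_left)
    also have "coprime (2 ^ nat r) (int p)"
      using cop by (metis coprime_commute coprime_int_iff coprime_power_left_iff of_nat_numeral)
    then have "[two_power_mod p (- r) * 2 ^ nat r = 1] (mod int p)"
      using False by (simp add: two_power_mod_def cong_modular_inverse2)
    finally show ?thesis .
  qed
qed

lemma composite_if_prime_dvd:
  assumes "prime p" "p dvd n" "p < n"
  shows "composite n"
  unfolding composite_def using assms prime_gt_1_nat[of p] primes_dvd_imp_eq[of p n] by fastforce

theorem theorem3p4:
  fixes k :: nat
  assumes "covering_riesel k"
  shows "\<forall>b\<ge>2. infinite {t. t \<ge> 1 \<and> riesel (repinteger b k t)}"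
proof (intro allI impI)
  fix b :: nat
  assume b: "b \<ge> 2"
  from assms obtain \<tau> :: nat and r m p where "odd k"
    and cover: "covering_system {1..\<tau>} r m"
    and p: "\<And>j. j \<in> {1..\<tau>} \<Longrightarrow> prime (p j) \<and> p j dvd 2 ^ m j - 1 \<and>
           [int k = two_power_mod (p j) (- r j)] (mod int (p j)) \<and>
           (\<forall>n>0. k * 2 ^ n - 1 > p j)"
    unfolding covering_riesel_def by blast
  \<comment> \<open>The factor 2 is \<open>q * (q - 1)\<close> for \<open>q = 2\<close>; it will
    make \<open>S\<close> odd.\<close>
  define N where "N = 2 * (\<Prod>j\<in>{1..\<tau>}. p j * (p j - 1))"
  have dvd_N: "p j * (p j - 1) dvd N" if "j \<in> {1..\<tau>}" for j
    unfolding N_def using that by (intro dvd_mult dvd_prodI) auto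
  \<comment> \<open>Positivity makes the values \<open>Suc (N * s)\<close> pairwise distinct, hence
    infinitely many.\<close>
  have "N > 0"
    unfolding N_def using p by (auto intro!: prod_pos simp: prime_gt_0_nat prime_gt_Suc_0_nat)
  have "riesel (repinteger b k (Suc (N * s)))" for s
  proof -
    define S where "S = (\<Sum>i<Suc (N * s). (b ^ num_digits b k) ^ i)"
    have K: "repinteger b k (Suc (N * s)) = k * S"
      unfolding S_def using b by (rule repinteger_eq_geometric_sum)
    have S_mod: "[S = 1] (mod q)" if "prime q" "q * (q - 1) dvd N" for q
      unfolding S_def using that by (intro geometric_sum_cong_1_mod_prime) auto
    have "odd S" using S_mod[of 2] by (simp add: N_def cong_def odd_iff_mod_2_eq_one)
    moreover from this have "S \<ge> 1" by (cases S) auto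
    moreover have "composite (k * S * 2 ^ n - 1)" if "n > 0" for n
    proof -
      obtain j where j: "j \<in> {1..\<tau>}" and "[int n = r j] (mod int (m j))"
        using cover unfolding covering_system_def by blast
      moreover have "m j > 0" using cover j unfolding covering_system_def by blast
      ultimately have "[two_power_mod (p j) (- r j) * 2 ^ n = 1] (mod int (p j))"
        using p by (intro two_power_mod_uminus_mult) auto
      then have "[int k * 2 ^ n = 1] (mod int (p j))"
        using p[OF j] by (meson cong_scalar_right cong_trans)
      then have "[k * 2 ^ n = 1] (mod p j)" by (simp flip: cong_int_iff)
      from cong_mult[OF this S_mod[of "p j"]] have "[k * S * 2 ^ n = 1] (mod p j)"
        using p[OF j] dvd_N[OF j] by (simp add: mult_ac)
      \<comment> \<open>The bound for \<open>k\<close> survives multiplication by \<open>S\<close>.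
        It shows that \<open>p j\<close> is a proper divisor and that the subtraction of 1 is not
        truncated.\<close>
      moreover have less: "p j < k * S * 2 ^ n - 1"
      proof (rule less_le_trans)
        show "p j < k * 2 ^ n - 1" using p[OF j] that by blast
        show "k * 2 ^ n - 1 \<le> k * S * 2 ^ n - 1"
          using \<open>S \<ge> 1\<close> by (intro diff_le_mono mult_le_mono1) simp
      qed
      then have "1 \<le> k * S * 2 ^ n" by linarith
      ultimately have "p j dvd k * S * 2 ^ n - 1" by (simp only: cong_altdef_nat)
      then show ?thesis using composite_if_prime_dvd p[OF j] less by blast
    qed
    ultimately show ?thesis
      using \<open>odd k\<close> by (simp add: riesel_def K)
  qed
  then have "range (\<lambda>s. Suc (N * s)) \<subseteq> {t. t \<ge> 1 \<and> riesel (repinteger b k t)}"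
    by auto
  moreover have "infinite (range (\<lambda>s. Suc (N * s)))"
    using \<open>N > 0\<close> by (intro range_inj_infinite injI) simp
  ultimately show "infinite {t. t \<ge> 1 \<and> riesel (repinteger b k t)}"
    using infinite_super by blast
qed

end
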